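(* For every real number $x>0$, $$Q_{2k-1}(x)\sim\sqrt{kx}\,Q_{2k}(x)\qquad (k\to\infty),$$ i.e. $\displaystyle\lim_{k\to\infty}\frac{Q_{2k-1}(x)}{\sqrt{kx}\,Q_{2k}(x)}=1$.
   Context: For an integer $m\ge1$ let $c_m=c_m(x)$ be $x$ if $m$ is odd and $\frac{2}{m}$ if $m$ is even. The polynomials $Q_n(x)$ are defined by $Q_{-1}(x)=0$, $Q_0(x)=1$, and $Q_n(x)=c_nQ_{n-1}(x)+Q_{n-2}(x)$ for $n\ge1$. *)

theory Defs
  imports Complex_Main "HOL-Computational_Algebra.Polynomial"
begin

definition c :: "int \<Rightarrow> real poly" where
  "c m = (if odd m then [:0, 1:] else [:2 / real_of_int m:])"

text \<open>The index is an integer so that the recursion can start at \<open>-1\<close>;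
  the value \<open>0\<close> for indices below \<open>-1\<close> is a convention that is never used.\<close>

function Q :: "int \<Rightarrow> real poly" where
  "Q n = (if n \<le> -1 then 0 else if n = 0 then 1 else c n * Q (n - 1) + Q (n - 2))"
  by auto
termination by (relation "measure (\<lambda>n. nat (n + 1))") auto

declare Q.simps [simp del]

lemma Q_minus_one: "Q (-1) = 0"
  by (simp add: Q.simps)

lemma Q_zero: "Q 0 = 1"
  by (simp add: Q.simps)

lemma Q_rec: "n \<ge> 1 \<Longrightarrow> Q n = c n * Q (n - 1) + Q (n - 2)"
  by (subst Q.simps) simp

end

theory Submission
  imports Defs
begin

text \<open>The ratio \<open>r\<^sub>k = Q\<^sub>2\<^sub>k\<^sub>-\<^sub>1 / Q\<^sub>2\<^sub>k\<close> satisfies \<open>1 / r\<^sub>k\<^sub>+\<^sub>1 = 1 / (k + 1) + 1 / (x + r\<^sub>k)\<close>, a step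
  increasing in \<open>r\<^sub>k\<close>. For this step \<open>sqrt (k x) + sqrt x\<close> is a supersolution and
  \<open>sqrt (k x) - (1 + x)\<close> a subsolution, so \<open>r\<^sub>k = sqrt (k x) + O(1)\<close>.\<close>

text \<open>The step is increasing in \<open>r\<close>, so it is enough to check
  \<open>r = U\<close>. With denominators cleared the claim there is
  \<open>n * x + n * U \<le> V * (x + U) + n * V\<close>, the sum of the last hypothesis and
  \<open>n\<close> times \<open>U \<le> V\<close>.\<close>

lemma ratio_step_upper:
  fixes n x r U V :: real
  assumes "n > 0" "x > 0" "r \<ge> 0" "r \<le> U" "U \<le> V" "n * x \<le> V * (x + U)"
  shows "n * (x + r) / (n + (x + r)) \<le> V"
proof (cases "n \<le> V")
  case True
  \<comment> \<open>The step never exceeds \<open>n\<close>. This covers the case where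
    \<open>n - V\<close> has the wrong sign for the monotonicity argument.\<close>
  have "n * (x + r) \<le> n * (n + (x + r))"
    using assms by (intro mult_left_mono) auto
  also have "\<dots> \<le> V * (n + (x + r))"
    using True assms by (intro mult_right_mono) auto
  finally show ?thesis
    using assms by (simp add: divide_le_eq)
next
  case False
  have "(n - V) * (x + r) \<le> (n - V) * (x + U)"
    using False assms by (intro mult_left_mono) auto
  moreover have "n * U \<le> n * V"
    using assms by (intro mult_left_mono) auto
  ultimately have "n * (x + r) \<le> V * (n + (x + r))"
    using assms(6) by (simp add: algebra_simps)
  then show ?thesis
    using assms by (simp add: divide_le_eq)
qed

text \<open>The last hypothesis is the claim at \<open>r = L\<close> with denominators cleared;
  \<open>M \<le> n\<close> carries it over to larger \<open>r\<close>.\<close>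

lemma ratio_step_lower:
  fixes n x r L M :: real
  assumes "n > 0" "x > 0" "r \<ge> 0" "L \<le> r" "M \<le> n" "n * (M - L - x) + M * (x + L) \<le> 0"
  shows "M \<le> n * (x + r) / (n + (x + r))"
proof -
  have "(n - M) * L \<le> (n - M) * r"
    using assms by (intro mult_left_mono) auto
  then have "M * (n + (x + r)) \<le> n * (x + r)"
    using assms(6) by (simp add: algebra_simps)
  then show ?thesis
    using assms by (simp add: le_divide_eq)
qed

text \<open>The growth \<open>n * (M - L)\<close> is at most \<open>s\<close>, while
  \<open>M * (x + L)\<close> falls short of \<open>n * x = s * s\<close> by at least about
  \<open>(2 + x) * s\<close>. Subtracting \<open>1 + x\<close> leaves this surplus and makes
  \<open>x + L\<close> equal to \<open>t - 1\<close>.\<close>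

lemma sqrt_subsolution:
  fixes n x :: real
  assumes "n \<ge> 1" "x > 0" "1 + x \<le> sqrt (n * x)"
  defines "M \<equiv> sqrt (n * x) - (1 + x)" and "L \<equiv> sqrt ((n - 1) * x) - (1 + x)"
  shows "n * (M - L - x) + M * (x + L) \<le> 0"
proof -
  define s t where "s = sqrt (n * x)" and "t = sqrt ((n - 1) * x)"
  have s2: "s * s = n * x" and t2: "t * t = (n - 1) * x"
    using assms(1,2) by (simp_all add: s_def t_def)
  have t0: "0 \<le> t" and ts: "t \<le> s" and s1: "1 + x \<le> s"
    using assms by (auto simp: s_def t_def)
  \<comment> \<open>A difference of squares gives \<open>s - t \<le> x / s\<close>; multiplying by
    \<open>n = s * s / x\<close> turns this into \<open>n * (s - t) \<le> s\<close>.\<close>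
  have "(s - t) * s \<le> (s - t) * (s + t)"
    using t0 ts by (intro mult_left_mono) auto
  also have "\<dots> = x"
    using s2 t2 by (simp add: algebra_simps)
  finally have "n * ((s - t) * s) \<le> n * x"
    using assms(1) by (intro mult_left_mono) auto
  then have "s * (n * (s - t)) \<le> s * s"
    using s2 by (simp add: algebra_simps)
  then have 1: "n * (s - t) \<le> s"
    using s1 assms(2) by (simp add: mult_le_cancel_left)
  have M_L_eqs: "M = s - (1 + x)" "L = t - (1 + x)"
    by (simp_all add: M_def L_def s_def t_def)
  have "M * (x + L) \<le> (s - (1 + x)) * (s - 1)"
    unfolding M_L_eqs using ts s1 by (intro mult_left_mono) auto
  then have "n * (M - L - x) + M * (x + L) \<le> s - n * x + (s - (1 + x)) * (s - 1)"
    using 1 by (simp add: M_L_eqs algebra_simps)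
  also have "\<dots> = (1 + x) * (1 - s)"
    using s2 by (simp add: algebra_simps)
  also have "\<dots> \<le> 0"
    using s1 assms(2) by (intro mult_nonneg_nonpos) auto
  finally show ?thesis .
qed

lemma ratio_recurrence_bounds:
  fixes r :: "nat \<Rightarrow> real" and x :: real
  assumes x: "x > 0" and r0: "r 0 = 0"
    and rec: "\<And>k. r (Suc k) = real (Suc k) * (x + r k) / (real (Suc k) + (x + r k))"
  shows "r k \<ge> 0" "r k \<le> sqrt (real k * x) + sqrt x" "sqrt (real k * x) - (1 + x) \<le> r k"
proof -
  have pos: "r k \<ge> 0" for k
    by (induction k) (use x r0 rec in auto)
  show "r k \<ge> 0" by (rule pos)
  show "r k \<le> sqrt (real k * x) + sqrt x"
  proof (induction k)
    case 0
    then show ?case using x r0 by simp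
  next
    case (Suc k)
    let ?s = "sqrt (real (Suc k) * x)" and ?t = "sqrt (real k * x)"
    \<comment> \<open>Subadditivity of the square root is what the summand \<open>sqrt x\<close> in
      the upper bound is chosen for: the previous bound already dominates \<open>?s\<close>.\<close>
    have "?s \<le> ?t + sqrt x"
      using sqrt_add_le_add_sqrt[of "real k * x" x] x by (simp add: algebra_simps)
    then have "?s * ?s \<le> (?s + sqrt x) * (x + (?t + sqrt x))"
      using x by (intro mult_mono) auto
    then have "real (Suc k) * x \<le> (?s + sqrt x) * (x + (?t + sqrt x))"
      using x by simp
    then show ?case
      unfolding rec
      by (intro ratio_step_upper[OF _ x pos Suc.IH]) (use x in auto)
  qed
  show "sqrt (real k * x) - (1 + x) \<le> r k"
  proof (induction k)
    case 0
    then show ?case using x r0 by simp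
  next
    case (Suc k)
    let ?s = "sqrt (real (Suc k) * x)"
    show ?case
    \<comment> \<open>The subsolution estimate needs a nonnegative lower bound; a negative one holds
      trivially.\<close>
    proof (cases "1 + x \<le> ?s")
      case True
      have "?s \<le> (real (Suc k) + x) / 2"
        using x by (intro arith_geo_mean_sqrt) auto
      then have "?s - (1 + x) \<le> real (Suc k)"
        using x by (simp add: field_simps)
      then show ?thesis
        unfolding rec
        using sqrt_subsolution[OF _ x True]
        by (intro ratio_step_lower[OF _ x pos Suc.IH]) auto
    next
      case False
      then show ?thesis using pos[of "Suc k"] by linarith
    qed
  qed
qed

lemma ratio_recurrence_asymptotics:
  fixes r :: "nat \<Rightarrow> real" and x :: real
  assumes x: "x > 0" and r0: "r 0 = 0"
    and rec: "\<And>k. r (Suc k) = real (Suc k) * (x + r k) / (real (Suc k) + (x + r k))"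
  shows "(\<lambda>k. r k / sqrt (real k * x)) \<longlonglongrightarrow> 1"
proof (rule real_tendsto_sandwich)
  note bounds = ratio_recurrence_bounds[of x r, OF x r0 rec]
  have *: "sqrt (real k * x) > 0" if "k > 0" for k
    using that x by simp
  \<comment> \<open>At \<open>k = 0\<close> division by zero yields 0 and the inequality would read
    \<open>1 \<le> 0\<close>, hence the restriction to \<open>k > 0\<close>.\<close>
  show "\<forall>\<^sub>F k in sequentially. 1 - (1 + x) / sqrt (real k * x) \<le> r k / sqrt (real k * x)"
    using eventually_gt_at_top[of 0]
  proof eventually_elim
    case (elim k)
    then show ?case
      using divide_right_mono[OF bounds(3), of "sqrt (real k * x)" k] *[of k] x
      by (simp add: diff_divide_distrib)
  qed
  show "\<forall>\<^sub>F k in sequentially. r k / sqrt (real k * x) \<le> 1 + sqrt x / sqrt (real k * x)"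
    using eventually_gt_at_top[of 0]
  proof eventually_elim
    case (elim k)
    then show ?case
      using divide_right_mono[OF bounds(2), of "sqrt (real k * x)" k] *[of k] x
      by (simp add: add_divide_distrib)
  qed
  have "filterlim (\<lambda>k. sqrt (real k * x)) at_top sequentially"
    using x by (intro filterlim_compose[OF sqrt_at_top]
        filterlim_at_top_mult_tendsto_pos[OF tendsto_const _ filterlim_real_sequentially])
  then have lim: "(\<lambda>k. d / sqrt (real k * x)) \<longlonglongrightarrow> 0" for d
    by (intro real_tendsto_divide_at_top[OF tendsto_const])
  show "(\<lambda>k. 1 - (1 + x) / sqrt (real k * x)) \<longlonglongrightarrow> 1"
    using tendsto_diff[OF tendsto_const lim, of 1 "1 + x"] by simp
  show "(\<lambda>k. 1 + sqrt x / sqrt (real k * x)) \<longlonglongrightarrow> 1"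
    using tendsto_add[OF tendsto_const lim, of 1 "sqrt x"] by simp
qed

lemma poly_Q_odd:
  "poly (Q (2 * int (Suc k) - 1)) x = x * poly (Q (2 * int k)) x + poly (Q (2 * int k - 1)) x"
  using Q_rec[of "2 * int (Suc k) - 1"] by (simp add: c_def algebra_simps)

lemma poly_Q_even:
  "poly (Q (2 * int (Suc k))) x =
     poly (Q (2 * int (Suc k) - 1)) x / real (Suc k) + poly (Q (2 * int k)) x"
  using Q_rec[of "2 * int (Suc k)"] by (simp add: c_def field_simps)

text \<open>Ensures that the ratio has a nonzero denominator. The odd-index value is only
  nonnegative because it vanishes at \<open>k = 0\<close>.\<close>

lemma poly_Q_pos:
  assumes "x > 0"
  shows "poly (Q (2 * int k)) x > 0 \<and> poly (Q (2 * int k - 1)) x \<ge> 0"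
proof (induction k)
  case 0
  then show ?case by (simp add: Q_zero Q_minus_one)
next
  case (Suc k)
  then have "poly (Q (2 * int (Suc k) - 1)) x \<ge> 0"
    unfolding poly_Q_odd using assms by simp
  moreover from this have "poly (Q (2 * int (Suc k))) x > 0"
    unfolding poly_Q_even using Suc by (intro add_nonneg_pos) auto
  ultimately show ?case by simp
qed

theorem proposition6p2:
  fixes x :: real
  assumes "x > 0"
  shows "(\<lambda>k::nat. poly (Q (2 * int k - 1)) x / (sqrt (real k * x) * poly (Q (2 * int k)) x))
           \<longlonglongrightarrow> 1"
proof -
  define r where "r k = poly (Q (2 * int k - 1)) x / poly (Q (2 * int k)) x" for k :: nat
  have "r (Suc k) = real (Suc k) * (x + r k) / (real (Suc k) + (x + r k))" for k
  proof -
    define a b n where "a = poly (Q (2 * int k)) x" and "b = poly (Q (2 * int k - 1)) x"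
      and "n = real (Suc k)"
    have pos: "a > 0" "b \<ge> 0" "n > 0"
      using poly_Q_pos[OF assms, of k] by (auto simp: a_def b_def n_def)
    have "r (Suc k) = (x * a + b) / ((x * a + b) / n + a)"
      unfolding r_def poly_Q_even poly_Q_odd a_def b_def n_def ..
    \<comment> \<open>Cancelling \<open>a\<close> leaves an expression in the ratio
      \<open>b / a = r k\<close> alone.\<close>
    also have "\<dots> = (x + b / a) / ((x + b / a) / n + 1)"
    proof -
      have "x * a + b = a * (x + b / a)"
        using pos by (simp add: field_simps)
      moreover have "a * (x + b / a) / n + a = a * ((x + b / a) / n + 1)"
        by (simp add: algebra_simps)
      ultimately show ?thesis
        using pos by simp
    qed
    also have "(x + b / a) / n + 1 = (n + (x + b / a)) / n"
      using pos by (simp add: add_divide_distrib)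
    also have "(x + b / a) / \<dots> = n * (x + b / a) / (n + (x + b / a))"
      by simp
    finally show ?thesis
      by (simp add: r_def a_def b_def n_def)
  qed
  moreover have "r 0 = 0"
    by (simp add: r_def Q_minus_one)
  ultimately have "(\<lambda>k. r k / sqrt (real k * x)) \<longlonglongrightarrow> 1"
    by (intro ratio_recurrence_asymptotics assms)
  then show ?thesis
    by (simp add: r_def mult.commute)
qed

end
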